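(* Let $\mathcal{A}$ be an algebra over $\mathbb{C}$ with unit $1$ and let $\mathcal{M}$ be a unital $\mathcal{A}$-bimodule. Suppose that $\mathcal{A}$ commutes with $\mathcal{M}$, i.e. $am=ma$ for every $a\in\mathcal{A}$ and $m\in\mathcal{M}$. Then, for $n\geq 2$, every 2-local inner derivation $\Delta: M_{n}(\mathcal{A})\rightarrow M_{n}(\mathcal{M})$ is an inner derivation.
   Context: $M_n(\mathcal{A})$ is the algebra of $n\times n$ matrices over $\mathcal{A}$, and $M_n(\mathcal{M})$ is the space of $n\times n$ matrices over $\mathcal{M}$ with its natural $M_n(\mathcal{A})$-bimodule structure given by matrix multiplication. For an algebra $\mathcal{B}$ and a $\mathcal{B}$-bimodule $\mathcal{N}$, an inner derivation $\mathcal{B}\to\mathcal{N}$ is a map of the form $a\mapsto ma-am$ for some $m\in\mathcal{N}$. A map $\Delta:\mathcal{B}\to\mathcal{N}$ (not assumed linear) is a 2-local inner derivation if for every $x,y\in\mathcal{B}$ there is an inner derivation $D_{x,y}:\mathcal{B}\to\mathcal{N}$ with $D_{x,y}(x)=\Delta(x)$ and $D_{x,y}(y)=\Delta(y)$. *)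

theory Defs
  imports "HOL-Analysis.Finite_Cartesian_Product"
begin

text \<open>Algebras and bimodules carry explicit operations rather than type class structure, because
  the library multiplication on \<^typ>\<open>'a^'n^'n\<close> is componentwise and because the class
  \<^class>\<open>ring_1\<close> would exclude the zero algebra.\<close>

locale unital_algebra = vector_space scale
  for scale :: "complex \<Rightarrow> 'a \<Rightarrow> 'a::ab_group_add" +
  fixes mul :: "'a \<Rightarrow> 'a \<Rightarrow> 'a"
    and unit :: 'a
  assumes mul_assoc: "mul (mul a b) c = mul a (mul b c)"
    and mul_add_left: "mul (a + b) c = mul a c + mul b c"
    and mul_add_right: "mul a (b + c) = mul a b + mul a c"
    and mul_scale_left: "mul (scale z a) b = scale z (mul a b)"
    and mul_scale_right: "mul a (scale z b) = scale z (mul a b)"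
    and unit_mul: "mul unit a = a"
    and mul_unit: "mul a unit = a"

locale unital_bimodule =
  unital_algebra scaleA mul unit + M: vector_space scaleM
  for scaleA :: "complex \<Rightarrow> 'a \<Rightarrow> 'a::ab_group_add"
    and mul :: "'a \<Rightarrow> 'a \<Rightarrow> 'a"
    and unit :: 'a
    and scaleM :: "complex \<Rightarrow> 'm \<Rightarrow> 'm::ab_group_add" +
  fixes lact :: "'a \<Rightarrow> 'm \<Rightarrow> 'm"
    and ract :: "'m \<Rightarrow> 'a \<Rightarrow> 'm"
  assumes lact_add_left: "lact (a + b) m = lact a m + lact b m"
    and lact_add_right: "lact a (m + p) = lact a m + lact a p"
    and lact_scale_left: "lact (scaleA z a) m = scaleM z (lact a m)"
    and lact_scale_right: "lact a (scaleM z m) = scaleM z (lact a m)"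
    and ract_add_left: "ract (m + p) a = ract m a + ract p a"
    and ract_add_right: "ract m (a + b) = ract m a + ract m b"
    and ract_scale_left: "ract (scaleM z m) a = scaleM z (ract m a)"
    and ract_scale_right: "ract m (scaleA z a) = scaleM z (ract m a)"
    and lact_mul: "lact (mul a b) m = lact a (lact b m)"
    and ract_mul: "ract m (mul a b) = ract (ract m a) b"
    and lact_ract: "ract (lact a m) b = lact a (ract m b)"
    and lact_unit: "lact unit m = m"
    and ract_unit: "ract m unit = m"

definition inner_derivation ::
    "('b \<Rightarrow> 'c \<Rightarrow> 'c) \<Rightarrow> ('c \<Rightarrow> 'b \<Rightarrow> 'c) \<Rightarrow> ('b \<Rightarrow> 'c::ab_group_add) \<Rightarrow> bool" where
  "inner_derivation lact ract D \<longleftrightarrow> (\<exists>m. D = (\<lambda>a. ract m a - lact a m))"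

definition two_local_inner_derivation ::
    "('b \<Rightarrow> 'c \<Rightarrow> 'c) \<Rightarrow> ('c \<Rightarrow> 'b \<Rightarrow> 'c) \<Rightarrow> ('b \<Rightarrow> 'c::ab_group_add) \<Rightarrow> bool" where
  "two_local_inner_derivation lact ract \<Delta> \<longleftrightarrow>
     (\<forall>x y. \<exists>D. inner_derivation lact ract D \<and> D x = \<Delta> x \<and> D y = \<Delta> y)"

text \<open>Matrix multiplication along a product \<open>f\<close> of entries; it yields the multiplication of
  $M_n(A)$ as well as its left and right actions on $M_n(M)$.\<close>

definition mat_prod ::
    "('a \<Rightarrow> 'b \<Rightarrow> 'c::comm_monoid_add) \<Rightarrow> 'a^'n^'l \<Rightarrow> 'b^'k^'n \<Rightarrow> 'c^'k^'l" where
  "mat_prod f X Y = (\<chi> i j. \<Sum>k\<in>UNIV. f (X $ i $ k) (Y $ k $ j))"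

definition mat_scale :: "(complex \<Rightarrow> 'a \<Rightarrow> 'a) \<Rightarrow> complex \<Rightarrow> 'a^'n^'l \<Rightarrow> 'a^'n^'l" where
  "mat_scale s z X = (\<chi> i j. s z (X $ i $ j))"

definition mat_unit :: "'a::zero \<Rightarrow> 'a^'n^'n" where
  "mat_unit u = (\<chi> i j. if i = j then u else 0)"

lemma mat_prod_times: "mat_prod (*) = ((**) :: 'a::semiring_1^'n^'l \<Rightarrow> 'a^'k^'n \<Rightarrow> _)"
  by (intro ext) (simp add: mat_prod_def matrix_matrix_mult_def)

lemma mat_prod_assoc:
  fixes f :: "'d::ab_group_add \<Rightarrow> 'c \<Rightarrow> 'e::ab_group_add"
    and g :: "'a \<Rightarrow> 'b \<Rightarrow> 'd"
    and f' :: "'a \<Rightarrow> 'r::ab_group_add \<Rightarrow> 'e"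
    and g' :: "'b \<Rightarrow> 'c \<Rightarrow> 'r"
  assumes assoc: "\<And>a b c. f (g a b) c = f' a (g' b c)"
    and add: "\<And>x y c. f (x + y) c = f x c + f y c" "\<And>a x y. f' a (x + y) = f' a x + f' a y"
  shows "mat_prod f (mat_prod g X Y) Z = mat_prod f' X (mat_prod g' Y Z)"
proof -
  have f: "f (sum h S) c = (\<Sum>i\<in>S. f (h i) c)" for h S c
    by (rule additive.sum[of "\<lambda>x. f x c"]) (simp add: additive_def add)
  have f': "f' a (sum h S) = (\<Sum>i\<in>S. f' a (h i))" for h S a
    by (rule additive.sum[of "f' a"]) (simp add: additive_def add)
  show ?thesis
    by (auto simp: mat_prod_def vec_eq_iff f f' assoc intro: sum.swap)
qed

text \<open>$M_n(M)$ is a unital bimodule over the unital algebra $M_n(A)$.\<close>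

lemma unital_bimodule_matrix:
  fixes scaleA :: "complex \<Rightarrow> 'a \<Rightarrow> 'a::ab_group_add"
    and scaleM :: "complex \<Rightarrow> 'm \<Rightarrow> 'm::ab_group_add"
  assumes "unital_bimodule scaleA mul unit scaleM lact ract"
  shows "unital_bimodule (mat_scale scaleA) (mat_prod mul) (mat_unit unit :: 'a^'n^'n)
    (mat_scale scaleM) (mat_prod lact) (mat_prod ract)"
proof -
  interpret unital_bimodule scaleA mul unit scaleM lact ract by fact
  have zero: "mul 0 a = 0" "mul a 0 = 0" "lact 0 m = 0" "ract m 0 = 0" for a m
    using mul_add_left[of 0 0 a] mul_add_right[of a 0 0] lact_add_left[of 0 0 m]
      ract_add_right[of m 0 0] by simp_all
  have delta: "f (if P then unit else 0) x = (if P then f unit x else f 0 x)"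
    "g x (if P then unit else 0) = (if P then g x unit else g x 0)"
    for f :: "'a \<Rightarrow> 'x \<Rightarrow> 'y" and g :: "'x \<Rightarrow> 'a \<Rightarrow> 'y" and P x
    by simp_all
  have ract_assoc: "mat_prod ract m (mat_prod mul a b) = mat_prod ract (mat_prod ract m a) b"
    for m :: "'m^'n^'n" and a b :: "'a^'n^'n"
    by (rule mat_prod_assoc[symmetric]) (simp_all add: ract_mul ract_add_left ract_add_right)
  show ?thesis
    by unfold_locales
      (simp_all add: mat_prod_assoc ract_assoc lact_mul lact_ract mul_assoc
        mul_add_left mul_add_right lact_add_left lact_add_right ract_add_left ract_add_right,
       simp_all add: vec_eq_iff mat_prod_def mat_scale_def mat_unit_def delta zero
        scale_right_distrib scale_left_distrib M.scale_right_distrib M.scale_left_distrib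
        scale_sum_right M.scale_sum_right sum.distrib
        mul_add_left mul_add_right mul_scale_left mul_scale_right unit_mul mul_unit
        lact_add_left lact_add_right lact_scale_left lact_scale_right lact_unit
        ract_add_left ract_add_right ract_scale_left ract_scale_right ract_unit
        cong: if_cong)
qed

end

theory Submission
  imports Defs
begin

text \<open>Since \<open>A\<close> commutes with \<open>M\<close>, the trace of \<open>M\<^sub>n(M)\<close> kills all values of inner derivations,
  so \<open>tr (D x \<cdot> y) = - tr (x \<cdot> D y)\<close> for \<open>D\<close> inner. This identity involves only two arguments, hence
  passes to a 2-local inner derivation \<open>\<Delta>\<close>. Subtract from \<open>\<Delta>\<close> an inner derivation agreeing with it
  at \<open>d\<close>, a diagonal matrix with distinct scalar entries, and at \<open>s\<close>, the matrix with all entries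
  \<open>1\<close>; now \<open>\<Delta> d = \<Delta> s = 0\<close>. Comparison with \<open>d\<close> shows that \<open>\<Delta> e\<^sub>i\<^sub>j\<close> is supported at the entry
  \<open>(i, j)\<close>, and that entry is \<open>tr (\<Delta> e\<^sub>i\<^sub>j \<cdot> s) = - tr (e\<^sub>i\<^sub>j \<cdot> \<Delta> s) = 0\<close>. Finally every entry of
  \<open>\<Delta> x\<close> is of the form \<open>tr (\<Delta> x \<cdot> e\<^sub>j\<^sub>i) = - tr (x \<cdot> \<Delta> e\<^sub>j\<^sub>i) = 0\<close>.\<close>

locale commuting_bimodule = unital_bimodule +
  assumes lact_eq_ract: "lact a m = ract m a"
begin

lemma ract_zero [simp]: "ract 0 a = 0" "ract m 0 = 0"
  using ract_add_left[of 0 0 a] ract_add_right[of m 0 0] by simp_all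

lemma ract_minus_left: "ract (m - p) a = ract m a - ract p a"
  using ract_add_left[of "m - p" p a] by simp

lemma ract_sum_left: "ract (sum f S) a = (\<Sum>i\<in>S. ract (f i) a)"
  by (induction S rule: infinite_finite_induct) (simp_all add: ract_add_left)

text \<open>Reading one factor as a left action turns this into \<open>lact_ract\<close>;
  \<open>mul\<close> itself may be noncommutative.\<close>

lemma ract_commute: "ract (ract m a) b = ract (ract m b) a"
  using lact_ract[of a m b] by (simp add: lact_eq_ract)

definition bracket :: "'b^'n^'n \<Rightarrow> 'a^'n^'n \<Rightarrow> 'b^'n^'n" where
  "bracket m x = mat_prod ract m x - mat_prod lact x m"

lemma bracket_nth:
  "bracket m x $ i $ j = (\<Sum>k\<in>UNIV. ract (m $ i $ k) (x $ k $ j) - ract (m $ k $ j) (x $ i $ k))"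
  by (simp add: bracket_def mat_prod_def lact_eq_ract sum_subtractf)

lemma bracket_minus_left: "bracket (m - p) x = bracket m x - bracket p x"
  by (simp add: vec_eq_iff bracket_nth ract_minus_left algebra_simps flip: sum_subtractf)

lemma two_local_iff_bracket:
  "two_local_inner_derivation (mat_prod lact) (mat_prod ract) \<Delta> \<longleftrightarrow>
    (\<forall>x y. \<exists>m. \<Delta> x = bracket m x \<and> \<Delta> y = bracket m y)"
proof -
  have "(\<exists>D. inner_derivation (mat_prod lact) (mat_prod ract) D \<and> D x = \<Delta> x \<and> D y = \<Delta> y) \<longleftrightarrow>
      (\<exists>m. \<Delta> x = bracket m x \<and> \<Delta> y = bracket m y)" for x y
    unfolding inner_derivation_def bracket_def by (auto dest: sym)
  then show ?thesis
    unfolding two_local_inner_derivation_def by simp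
qed

text \<open>The trace of the product \<open>mat_prod ract m x\<close>.\<close>

definition trace_pairing :: "'b^'n^'n \<Rightarrow> 'a^'n^'n \<Rightarrow> 'b" where
  "trace_pairing m x = (\<Sum>i\<in>UNIV. \<Sum>k\<in>UNIV. ract (m $ i $ k) (x $ k $ i))"

lemma trace_pairing_zero [simp]: "trace_pairing 0 x = 0"
  by (simp add: trace_pairing_def)

lemma trace_pairing_minus_left:
  "trace_pairing (m - p) x = trace_pairing m x - trace_pairing p x"
  by (simp add: trace_pairing_def ract_minus_left sum_subtractf)

text \<open>Cyclicity of the trace, tr(xmy) = tr(myx); it rests on \<open>ract_commute\<close>,
  which lets the entries of \<open>x\<close> and \<open>y\<close> act in either order.\<close>

lemma trace_pairing_lact:
  "trace_pairing (mat_prod lact x m) y = trace_pairing (mat_prod ract m y) x"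
proof -
  have "trace_pairing (mat_prod lact x m) y =
      (\<Sum>i\<in>UNIV. \<Sum>k\<in>UNIV. \<Sum>j\<in>UNIV. ract (ract (m $ j $ k) (y $ k $ i)) (x $ i $ j))"
    by (simp add: trace_pairing_def mat_prod_def lact_eq_ract ract_sum_left ract_commute)
  also have "\<dots> = (\<Sum>i\<in>UNIV. \<Sum>j\<in>UNIV. \<Sum>k\<in>UNIV. ract (ract (m $ j $ k) (y $ k $ i)) (x $ i $ j))"
    by (intro sum.cong refl sum.swap)
  also have "\<dots> = trace_pairing (mat_prod ract m y) x"
    unfolding trace_pairing_def mat_prod_def by (subst sum.swap) (simp add: ract_sum_left)
  finally show ?thesis .
qed

text \<open>By cyclicity the left side is tr(mxy) - tr(myx), which changes sign when
  \<open>x\<close> and \<open>y\<close> are swapped.\<close>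

lemma trace_pairing_bracket:
  "trace_pairing (bracket m x) y = - trace_pairing (bracket m y) x"
  by (simp add: bracket_def trace_pairing_minus_left trace_pairing_lact)

lemma trace_pairing_two_local:
  assumes "two_local_inner_derivation (mat_prod lact) (mat_prod ract) \<Delta>"
  shows "trace_pairing (\<Delta> x) y = - trace_pairing (\<Delta> y) x"
proof -
  obtain m where "\<Delta> x = bracket m x" "\<Delta> y = bracket m y"
    using assms unfolding two_local_iff_bracket by blast
  then show ?thesis
    by (simp add: trace_pairing_bracket[of m x])
qed

definition matrix_unit :: "'n \<Rightarrow> 'n \<Rightarrow> 'a^'n^'n" where
  "matrix_unit i j = (\<chi> k l. if k = i \<and> l = j then unit else 0)"

lemma ract_if_unit: "ract m (if P then unit else 0) = (if P then m else 0)"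
  by (simp add: ract_unit)

lemma trace_pairing_matrix_unit: "trace_pairing m (matrix_unit j i) = m $ i $ j"
proof -
  have "trace_pairing m (matrix_unit j i) =
      (\<Sum>k\<in>UNIV. if k = i then \<Sum>l\<in>UNIV. if l = j then m $ k $ l else 0 else 0)"
    unfolding trace_pairing_def by (intro sum.cong refl) (auto simp: matrix_unit_def ract_if_unit)
  then show ?thesis
    by simp
qed

text \<open>The \<open>(i, j)\<close> entry of the bracket is \<open>m $ i $ j\<close> scaled by the
  nonzero complex number \<open>z j - z i\<close>, which can be cancelled in a vector space.\<close>

lemma centralizer_diagonal:
  fixes m :: "'b^'n^'n"
  assumes "inj z" and "bracket m (\<chi> i j. if i = j then scaleA (z i) unit else 0) = 0"
    and "i \<noteq> j"
  shows "m $ i $ j = 0"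
proof -
  have "0 = bracket m (\<chi> i j. if i = j then scaleA (z i) unit else 0) $ i $ j"
    by (simp add: assms(2))
  also have "\<dots> = (\<Sum>k\<in>UNIV. (if k = j then scaleM (z j) (m $ i $ j) else 0)
      - (if k = i then scaleM (z i) (m $ i $ j) else 0))"
    unfolding bracket_nth
    by (intro sum.cong refl) (auto simp: ract_scale_right ract_unit)
  also have "\<dots> = scaleM (z j - z i) (m $ i $ j)"
    by (simp add: sum_subtractf M.scale_left_diff_distrib)
  finally show ?thesis
    using assms(1,3) by (auto simp: M.scale_eq_0_iff dest: injD)
qed

text \<open>For diagonal \<open>m\<close>, multiplying \<open>matrix_unit i j\<close> by
  \<open>m\<close> on either side only rescales its entry at \<open>(i, j)\<close>.\<close>

lemma bracket_diagonal_matrix_unit: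
  assumes "\<And>k l. k \<noteq> l \<Longrightarrow> m $ k $ l = 0" and "(k, l) \<noteq> (i, j)"
  shows "bracket m (matrix_unit i j) $ k $ l = 0"
  unfolding bracket_nth using assms
  by (intro sum.neutral) (auto simp: matrix_unit_def ract_if_unit)

lemma two_local_eq_zero:
  fixes \<Delta> :: "'a^'n^'n \<Rightarrow> 'b^'n^'n"
  assumes loc: "two_local_inner_derivation (mat_prod lact) (mat_prod ract) \<Delta>"
    and "inj z" and d: "\<Delta> (\<chi> i j. if i = j then scaleA (z i) unit else 0) = 0"
    and s: "\<Delta> (\<chi> i j. unit) = 0"
  shows "\<Delta> x = 0"
proof -
  have off: "\<Delta> (matrix_unit i j) $ k $ l = 0" if ne: "(k, l) \<noteq> (i, j)" for i j k l
  proof -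
    \<comment> \<open>One \<open>m\<close> serves both arguments; as \<Delta> vanishes at the
      second, \<open>m\<close> commutes with that diagonal matrix and is itself diagonal.\<close>
    obtain m where m: "\<Delta> (matrix_unit i j) = bracket m (matrix_unit i j)"
      "\<Delta> (\<chi> i j. if i = j then scaleA (z i) unit else 0)
        = bracket m (\<chi> i j. if i = j then scaleA (z i) unit else 0)"
      using loc unfolding two_local_iff_bracket by blast
    show ?thesis
      unfolding m(1) using centralizer_diagonal[OF \<open>inj z\<close> m(2)[symmetric, unfolded d]] ne
      by (rule bracket_diagonal_matrix_unit)
  qed
  have "\<Delta> (matrix_unit i j) = 0" for i j
  proof -
    \<comment> \<open>Pairing with the all-\<open>unit\<close> matrix adds up all entries, and by
      \<open>off\<close> only the one at \<open>(i, j)\<close> can survive.\<close>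
    have "0 = trace_pairing (\<Delta> (matrix_unit i j)) (\<chi> i j. unit)"
      by (simp add: trace_pairing_two_local[OF loc, of "matrix_unit i j"] s)
    also have "\<dots> = (\<Sum>k\<in>UNIV. \<Sum>l\<in>UNIV. \<Delta> (matrix_unit i j) $ k $ l)"
      by (simp add: trace_pairing_def ract_unit)
    also have "\<dots> = (\<Sum>k\<in>UNIV. \<Sum>l\<in>UNIV.
        if k = i then if l = j then \<Delta> (matrix_unit i j) $ i $ j else 0 else 0)"
      by (intro sum.cong refl) (auto simp: off)
    also have "\<dots> = (\<Sum>k\<in>UNIV. if k = i then
        \<Sum>l\<in>UNIV. if l = j then \<Delta> (matrix_unit i j) $ i $ j else 0 else 0)"
      by (intro sum.cong refl) simp
    finally show ?thesis
      using off[of _ _ i j] by (simp add: vec_eq_iff) metis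
  qed
  then have "\<Delta> x $ i $ j = 0" for i j
    using trace_pairing_two_local[OF loc, of x "matrix_unit j i"]
    by (simp add: trace_pairing_matrix_unit)
  then show ?thesis
    by (simp add: vec_eq_iff)
qed

lemma two_local_imp_inner_derivation:
  fixes \<Delta> :: "'a^'n^'n \<Rightarrow> 'b^'n^'n"
  assumes loc: "two_local_inner_derivation (mat_prod lact) (mat_prod ract) \<Delta>"
  shows "inner_derivation (mat_prod lact) (mat_prod ract) \<Delta>"
proof -
  obtain f :: "'n \<Rightarrow> nat" where "inj f"
    using finite_imp_inj_to_nat_seg[of "UNIV :: 'n set"] by auto
  \<comment> \<open>Distinct diagonal scalars: a numbering of the finite index type, embedded in the
    complex numbers.\<close>
  define z :: "'n \<Rightarrow> complex" where "z i = of_nat (f i)" for i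
  have "inj z"
    using \<open>inj f\<close> by (auto simp: z_def inj_def)
  obtain m where d: "\<Delta> (\<chi> i j. if i = j then scaleA (z i) unit else 0)
        = bracket m (\<chi> i j. if i = j then scaleA (z i) unit else 0)"
    and s: "\<Delta> (\<chi> i j. unit) = bracket m (\<chi> i j. unit)"
    using loc unfolding two_local_iff_bracket by blast
  have "two_local_inner_derivation (mat_prod lact) (mat_prod ract) (\<lambda>x. \<Delta> x - bracket m x)"
    unfolding two_local_iff_bracket
  proof (intro allI)
    fix x y
    obtain p where "\<Delta> x = bracket p x" "\<Delta> y = bracket p y"
      using loc unfolding two_local_iff_bracket by blast
    then show "\<exists>p. \<Delta> x - bracket m x = bracket p x \<and> \<Delta> y - bracket m y = bracket p y"
      \<comment> \<open>The bracket is additive in its first argument, so \<open>p - m\<close>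
        implements the difference at both points.\<close>
      by (intro exI[of _ "p - m"]) (simp add: bracket_minus_left)
  qed
  then have "\<Delta> x - bracket m x = 0" for x
    using \<open>inj z\<close> by (rule two_local_eq_zero) (simp_all add: d s)
  then have "\<Delta> = (\<lambda>x. mat_prod ract m x - mat_prod lact x m)"
    by (simp add: fun_eq_iff bracket_def)
  then show ?thesis
    unfolding inner_derivation_def by blast
qed

end

theorem theorem3p2:
  fixes scaleA :: "complex \<Rightarrow> 'a \<Rightarrow> 'a::ab_group_add"
    and mul :: "'a \<Rightarrow> 'a \<Rightarrow> 'a"
    and unit :: 'a
    and scaleM :: "complex \<Rightarrow> 'm \<Rightarrow> 'm::ab_group_add"
    and lact :: "'a \<Rightarrow> 'm \<Rightarrow> 'm"
    and ract :: "'m \<Rightarrow> 'a \<Rightarrow> 'm"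
    and \<Delta> :: "'a^'n^'n \<Rightarrow> 'm^'n^'n"
  assumes "unital_bimodule scaleA mul unit scaleM lact ract"
    and "\<And>a m. lact a m = ract m a"
    and "CARD('n) \<ge> 2"
    and "two_local_inner_derivation (mat_prod lact) (mat_prod ract) \<Delta>"
  shows "inner_derivation (mat_prod lact) (mat_prod ract) \<Delta>"
proof -
  interpret commuting_bimodule scaleA mul unit scaleM lact ract
    using assms(1,2) by (intro commuting_bimodule.intro commuting_bimodule_axioms.intro)
  show ?thesis
    using assms(4) by (rule two_local_imp_inner_derivation)
qed

end
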